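(* Let $N\ge2$ and let $\phi_1,\dots,\phi_N$ be plane-wave seed functions with pairwise distinct $z_1,\dots,z_N$. Then $$\Phi^{(N)}(\phi_1,\dots,\phi_N)=\sum_{i=1}^{N-1}\Phi^{(N-1)}(\phi_1,\dots,\phi_{N-1})\Big|_{\phi_i\mapsto\frac1{z_{iN}}\{\phi_i,\phi_N\}},$$ where in the $i$-th summand the function $\phi_i$ is replaced by $\frac{1}{z_{iN}}\{\phi_i,\phi_N\}$ (all derivatives that acted on $\phi_i$ now act on this function), while all the factors $1/z_{jk}$ with $j,k\in\{1,\dots,N-1\}$ already present in $\Phi^{(N-1)}$ are left unchanged.
   Context: Coordinates $u,\bar u,w,\bar w$ are independent; $\{f,g\}=\partial_uf\,\partial_wg-\partial_wf\,\partial_ug$. For each $i$ fix complex $\omega_i\neq0,z_i,\bar z_i$, and set $z_{ij}=z_i-z_j$, $p_i\cdot X=\omega_i(u+z_i\bar z_i\bar u-\bar z_iw-z_i\bar w)$, and $\phi_i=\epsilon_ie^{\mathrm ip_i\cdot X}$ with commuting parameters $\epsilon_i$, $\epsilon_i^2=0$. $\Phi^{(n)}(\phi_{1},\dots,\phi_{n})$ is the part of the perturbiner expansion (tree-sum solution) of Plebański's second heavenly equation $(\partial_u\partial_{\bar u}-\partial_w\partial_{\bar w})\phi=\{\partial_u\phi,\partial_w\phi\}$ with seeds $\phi_1,\dots,\phi_n$ that contains every one of these seeds. Explicitly, $$\Phi^{(n)}(\phi_1,\dots,\phi_n)=\sum_{\mathbf t\in\mathcal T_n^{\max}}\Big(\prod_{\{i,j\}\in\text{edges}(\mathbf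 t)}\frac{D^{ij}}{z_{ij}}\Big)\phi_1\cdots\phi_n,$$ where $\mathcal T_n^{\max}$ is the set of all trees with vertex set exactly $\{1,\dots,n\}$, $D^{ij}=\partial_u^{(i)}\partial_w^{(j)}-\partial_u^{(j)}\partial_w^{(i)}$, and $\partial^{(i)}_\mu$ differentiates only the $i$-th factor of the product. With $z_1,\dots,z_n$ held fixed, this right-hand side is a multilinear differential expression that makes sense for arbitrary functions in the $n$ slots; the replacement of $\phi_i$ in the claim means inserting $\frac1{z_{iN}}\{\phi_i,\phi_N\}$ in the $i$-th slot of this expression with $n=N-1$. *)

theory Defs
  imports "HOL-Analysis.Analysis" "HOL-Library.FSet"
begin

section \<open>The algebra of the commuting square-zero parameters\<close>

text \<open>
  An element of \<open>eps_alg\<close> is a formal sum of square-free monomials in the parameters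
  \<open>\<epsilon>\<^sub>0, \<epsilon>\<^sub>1, \<dots>\<close> with complex coefficients; it is given by the coefficient of
  \<open>\<Prod>i\<in>S. \<epsilon>\<^sub>i\<close> for each finite set \<open>S\<close>.  Monomials with overlapping index sets multiply to zero.
  The elements that involve \<open>\<epsilon>\<^sub>1, \<dots>, \<epsilon>\<^sub>N\<close> only form the algebra
  \<open>\<complex>[\<epsilon>\<^sub>1, \<dots>, \<epsilon>\<^sub>N] / (\<epsilon>\<^sub>1\<^sup>2, \<dots>, \<epsilon>\<^sub>N\<^sup>2)\<close>.
\<close>

typedef eps_alg = "UNIV :: (nat fset \<Rightarrow> complex) set"
  morphisms ecoeff Abs_eps_alg
  by simp

setup_lifting type_definition_eps_alg

lemma eps_alg_eqI: "(\<And>S. ecoeff a S = ecoeff b S) \<Longrightarrow> a = b"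
  by (metis ecoeff_inject ext)

lemma finite_subfsets [simp]: "finite {T. T |\<subseteq>| (S :: 'a fset)}"
proof -
  have "{T. T |\<subseteq>| S} = fset (fPow S)"
    by auto
  then show ?thesis
    by (metis finite_fset)
qed

instantiation eps_alg :: comm_ring_1
begin

lift_definition zero_eps_alg :: eps_alg is "\<lambda>_. 0" .

lift_definition one_eps_alg :: eps_alg is "\<lambda>S. if S = {||} then 1 else 0" .

lift_definition plus_eps_alg :: "eps_alg \<Rightarrow> eps_alg \<Rightarrow> eps_alg" is "\<lambda>a b S. a S + b S" .

lift_definition minus_eps_alg :: "eps_alg \<Rightarrow> eps_alg \<Rightarrow> eps_alg" is "\<lambda>a b S. a S - b S" .

lift_definition uminus_eps_alg :: "eps_alg \<Rightarrow> eps_alg" is "\<lambda>a S. - a S" .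

lift_definition times_eps_alg :: "eps_alg \<Rightarrow> eps_alg \<Rightarrow> eps_alg"
  is "\<lambda>a b S. \<Sum>T | T |\<subseteq>| S. a T * b (S |-| T)" .

instance
proof
  fix a b c :: eps_alg
  show "a * b * c = a * (b * c)"
  proof (rule eps_alg_eqI)
    fix S
    have "ecoeff (a * b * c) S =
        (\<Sum>T | T |\<subseteq>| S. \<Sum>R | R |\<subseteq>| T. ecoeff a R * ecoeff b (T |-| R) * ecoeff c (S |-| T))"
      by (simp add: times_eps_alg.rep_eq sum_distrib_right)
    also have "\<dots> = (\<Sum>(T, R) \<in> (SIGMA T:{T. T |\<subseteq>| S}. {R. R |\<subseteq>| T}).
        ecoeff a R * ecoeff b (T |-| R) * ecoeff c (S |-| T))"
      by (rule sum.Sigma) auto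
    also have "\<dots> = (\<Sum>(R, Q) \<in> (SIGMA R:{R. R |\<subseteq>| S}. {Q. Q |\<subseteq>| S |-| R}).
        ecoeff a R * (ecoeff b Q * ecoeff c (S |-| R |-| Q)))"
    proof (rule sum.reindex_bij_witness
        [where i = "\<lambda>(R, Q). (R |\<union>| Q, R)" and j = "\<lambda>(T, R). (R, T |-| R)"], goal_cases)
      case (5 p)
      obtain T R where p: "p = (T, R)" by (cases p)
      with 5 have "R |\<subseteq>| T" "T |\<subseteq>| S" by auto
      then have "S |-| R |-| (T |-| R) = S |-| T" by auto
      then show ?case by (simp add: p mult.assoc)
    qed auto
    also have "\<dots> = (\<Sum>R | R |\<subseteq>| S. \<Sum>Q | Q |\<subseteq>| S |-| R.
        ecoeff a R * (ecoeff b Q * ecoeff c (S |-| R |-| Q)))"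
      by (rule sum.Sigma [symmetric]) auto
    also have "\<dots> = ecoeff (a * (b * c)) S"
      by (simp add: times_eps_alg.rep_eq sum_distrib_left)
    finally show "ecoeff (a * b * c) S = ecoeff (a * (b * c)) S" .
  qed
  show "a * b = b * a"
  proof (rule eps_alg_eqI)
    fix S
    have "(\<Sum>T | T |\<subseteq>| S. ecoeff a T * ecoeff b (S |-| T)) =
        (\<Sum>T | T |\<subseteq>| S. ecoeff b T * ecoeff a (S |-| T))"
    proof (rule sum.reindex_bij_witness
        [where i = "\<lambda>T. S |-| T" and j = "\<lambda>T. S |-| T"], goal_cases)
      case (5 T)
      then have "S |-| (S |-| T) = T" by auto
      then show ?case by simp
    qed auto
    then show "ecoeff (a * b) S = ecoeff (b * a) S"
      by (simp add: times_eps_alg.rep_eq)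
  qed
  show "1 * a = a"
  proof (rule eps_alg_eqI)
    fix S
    have "(\<Sum>T | T |\<subseteq>| S. (if T = {||} then 1 else 0) * ecoeff a (S |-| T)) =
        (\<Sum>T | T |\<subseteq>| S. if T = {||} then ecoeff a S else 0)"
      by (rule sum.cong) auto
    also have "\<dots> = ecoeff a S"
      by simp
    finally show "ecoeff (1 * a) S = ecoeff a S"
      by (simp add: times_eps_alg.rep_eq one_eps_alg.rep_eq)
  qed
  show "(a + b) * c = a * c + b * c"
    by (rule eps_alg_eqI)
      (simp add: times_eps_alg.rep_eq plus_eps_alg.rep_eq distrib_right sum.distrib)
  show "(0::eps_alg) \<noteq> 1"
    by transfer (metis zero_neq_one)
qed (transfer; auto)+

end

lift_definition eps_scale :: "complex \<Rightarrow> eps_alg \<Rightarrow> eps_alg"  (infixr \<open>*\<^sub>\<epsilon>\<close> 75)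
  is "\<lambda>c a S. c * a S" .

lift_definition eps :: "nat \<Rightarrow> eps_alg" is "\<lambda>i S. if S = {|i|} then 1 else 0" .

lemma eps_square: "eps i * eps i = 0"
proof (rule eps_alg_eqI)
  fix S
  have "(\<Sum>T | T |\<subseteq>| S. (if T = {|i|} then 1 else 0) * (if S |-| T = {|i|} then 1 else 0)) = (0 :: complex)"
    by (rule sum.neutral) auto
  then show "ecoeff (eps i * eps i) S = ecoeff 0 S"
    by (simp add: times_eps_alg.rep_eq eps.rep_eq zero_eps_alg.rep_eq)
qed


section \<open>Fields, derivatives and plane waves\<close>

text \<open>A point has the four independent complex coordinates \<open>(u, \<bar>u, w, \<bar>w)\<close>.\<close>

type_synonym point = "complex \<times> complex \<times> complex \<times> complex"

type_synonym field = "point \<Rightarrow> eps_alg"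

text \<open>Derivatives of functions with values in \<open>eps_alg\<close> are taken coefficientwise.\<close>

definition eps_deriv :: "(complex \<Rightarrow> eps_alg) \<Rightarrow> complex \<Rightarrow> eps_alg" where
  "eps_deriv f s = Abs_eps_alg (\<lambda>S. deriv (\<lambda>t. ecoeff (f t) S) s)"

definition du :: "field \<Rightarrow> field" where
  "du f = (\<lambda>(u, ub, w, wb). eps_deriv (\<lambda>t. f (t, ub, w, wb)) u)"

definition dw :: "field \<Rightarrow> field" where
  "dw f = (\<lambda>(u, ub, w, wb). eps_deriv (\<lambda>t. f (u, ub, t, wb)) w)"

definition bracket :: "field \<Rightarrow> field \<Rightarrow> field" where
  "bracket f g = (\<lambda>X. du f X * dw g X - dw f X * du g X)"

definition mom :: "(nat \<Rightarrow> complex) \<Rightarrow> (nat \<Rightarrow> complex) \<Rightarrow> (nat \<Rightarrow> complex) \<Rightarrow> nat \<Rightarrow> point \<Rightarrow> complex"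
  where "mom \<omega> z zb i = (\<lambda>(u, ub, w, wb). \<omega> i * (u + z i * zb i * ub - zb i * w - z i * wb))"

definition plane_wave ::
    "(nat \<Rightarrow> complex) \<Rightarrow> (nat \<Rightarrow> complex) \<Rightarrow> (nat \<Rightarrow> complex) \<Rightarrow> nat \<Rightarrow> field"
  where "plane_wave \<omega> z zb i = (\<lambda>X. exp (\<i> * mom \<omega> z zb i X) *\<^sub>\<epsilon> eps i)"


section \<open>Trees\<close>

definition is_tree :: "'v set \<Rightarrow> 'v set set \<Rightarrow> bool" where
  "is_tree V E \<longleftrightarrow>
     V \<noteq> {} \<and>
     E \<subseteq> {{i, j} | i j. i \<in> V \<and> j \<in> V \<and> i \<noteq> j} \<and>
     (\<forall>i\<in>V. \<forall>j\<in>V. (i, j) \<in> {(k, l). {k, l} \<in> E}\<^sup>*) \<and>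
     (\<nexists>vs. length vs \<ge> 3 \<and> distinct vs \<and>
        (\<forall>k < length vs. {vs ! k, vs ! (Suc k mod length vs)} \<in> E))"

text \<open>A tree on the vertex set \<open>{1..n}\<close> is identified with its set of edges.\<close>

definition trees :: "nat \<Rightarrow> nat set set set" where
  "trees n = {E. is_tree {1..n} E}"


section \<open>The perturbiner coefficient\<close>

text \<open>
  The formal product of \<open>n\<close> factors, on whose slots the derivatives act separately, is the function
  \<open>(X\<^sub>1, \<dots>, X\<^sub>n) \<mapsto> \<phi>\<^sub>1(X\<^sub>1) \<cdots> \<phi>\<^sub>n(X\<^sub>n)\<close> of \<open>n\<close> independent points.  After all derivatives have been taken
  the points are set equal.
\<close>

type_synonym multifield = "(nat \<Rightarrow> point) \<Rightarrow> eps_alg"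

definition slots :: "nat \<Rightarrow> (nat \<Rightarrow> field) \<Rightarrow> multifield" where
  "slots n \<phi> = (\<lambda>Xs. \<Prod>i = 1..n. \<phi> i (Xs i))"

definition in_slot :: "nat \<Rightarrow> (field \<Rightarrow> field) \<Rightarrow> multifield \<Rightarrow> multifield" where
  "in_slot i d G = (\<lambda>Xs. d (\<lambda>Y. G (Xs(i := Y))) (Xs i))"

definition D :: "nat \<Rightarrow> nat \<Rightarrow> multifield \<Rightarrow> multifield" where
  "D i j G = (\<lambda>Xs. in_slot i du (in_slot j dw G) Xs - in_slot j du (in_slot i dw G) Xs)"

definition edge_op :: "(nat \<Rightarrow> complex) \<Rightarrow> nat \<times> nat \<Rightarrow> multifield \<Rightarrow> multifield" where
  "edge_op z = (\<lambda>(i, j) G Xs. (1 / (z i - z j)) *\<^sub>\<epsilon> D i j G Xs)"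

text \<open>
  Each edge \<open>{i, j}\<close> is listed once, as \<open>(i, j)\<close> with \<open>i < j\<close>; the orientation is immaterial because
  \<open>D\<^sup>i\<^sup>j\<close> and \<open>z\<^sub>i - z\<^sub>j\<close> are both antisymmetric.  The product over the edges is the composition of the
  operators; its order is immaterial on smooth fields, where all partial derivatives commute.
\<close>

definition edge_list :: "nat \<Rightarrow> nat set set \<Rightarrow> (nat \<times> nat) list" where
  "edge_list n E = [(i, j) \<leftarrow> List.product [1..<Suc n] [1..<Suc n]. i < j \<and> {i, j} \<in> E]"

definition Phi :: "(nat \<Rightarrow> complex) \<Rightarrow> nat \<Rightarrow> (nat \<Rightarrow> field) \<Rightarrow> field" where
  "Phi z n \<phi> = (\<lambda>X. \<Sum>E\<in>trees n. foldr (edge_op z) (edge_list n E) (slots n \<phi>) (\<lambda>_. X))"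

end

theory Submission
  imports Defs "HOL-Library.Transitive_Closure_Table"
begin

text \<open>
  Exponentials are eigenvectors of the operators \<open>D\<^sup>i\<^sup>j\<close>, so both sides are scalar multiples of
  \<open>\<phi>\<^sub>1 \<cdots> \<phi>\<^sub>N\<close> and the claim becomes an identity between weighted sums over trees.  On the right-hand
  side an edge \<open>{i, j}\<close> of a tree on \<open>{1..N-1}\<close> gets a numerator that is a sum of two terms; taking the
  second one means moving the edge from \<open>i\<close> to \<open>N\<close>.  Expanding the product thus gives a sum over the
  trees on \<open>{1..N}\<close> with a distinguished edge \<open>{i, N}\<close>.  For a fixed tree, in which \<open>N\<close> has the set \<open>M\<close>
  of neighbours, the sum over the distinguished edge is the partial fraction decomposition of
  \<open>\<Prod>j\<in>M. 1 / (x - z\<^sub>j)\<close> at \<open>x = z\<^sub>N\<close>.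
\<close>

section \<open>Trees and contraction of an edge\<close>

definition adj :: "'v set set \<Rightarrow> ('v \<times> 'v) set" where
  "adj E = {(k, l). {k, l} \<in> E}"

definition nbrs :: "'v set set \<Rightarrow> 'v \<Rightarrow> 'v set" where
  "nbrs E x = {y. {x, y} \<in> E}"

lemma adj_iff: "(x, y) \<in> adj E \<longleftrightarrow> {x, y} \<in> E"
  by (simp add: adj_def)

lemma sym_adj: "sym (adj E)"
  by (auto simp: adj_def sym_def insert_commute)

lemma adj_rtrancl_sym: "(x, y) \<in> (adj E)\<^sup>* \<Longrightarrow> (y, x) \<in> (adj E)\<^sup>*"
  by (meson sym_adj sym_rtrancl symD)

text \<open>The common tool for transporting walks along a vertex map: one step may become a longer
  walk (a detour through another vertex) or the empty walk (a collapsed edge).\<close>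

lemma rtrancl_map:
  assumes "(x, y) \<in> R\<^sup>*" and "\<And>a b. (a, b) \<in> R \<Longrightarrow> (f a, f b) \<in> Q\<^sup>*"
  shows "(f x, f y) \<in> Q\<^sup>*"
  using assms(1) by induction (auto intro: rtrancl_trans assms(2))

lemma rtrancl_distinct_list:
  assumes "(x, y) \<in> R\<^sup>*"
  obtains vs where "distinct (x # vs)" "last (x # vs) = y"
    "\<forall>k < length vs. ((x # vs) ! k, vs ! k) \<in> R"
proof -
  have "(\<lambda>a b. (a, b) \<in> R)\<^sup>*\<^sup>* x y"
    using assms by (simp add: rtranclp_rtrancl_eq)
  then obtain us where "rtrancl_path (\<lambda>a b. (a, b) \<in> R) x us y"
    by (auto simp: rtranclp_eq_rtrancl_path)
  then obtain vs where vs: "rtrancl_path (\<lambda>a b. (a, b) \<in> R) x vs y" "distinct (x # vs)"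
    by (rule rtrancl_path_distinct)
  have "last (x # vs) = y"
    using vs(1) by (cases "vs = []") (auto dest: rtrancl_path_last elim: rtrancl_path.cases)
  then show thesis
    using vs(2) rtrancl_path_nth [OF vs(1)] by (auto intro!: that)
qed

text \<open>A cycle is an edge together with a walk between its ends that avoids this edge.
  Acyclicity thus says that every edge is a bridge, a statement about reachability that can be moved
  between graphs with \<open>rtrancl_map\<close>, unlike lists of distinct vertices.\<close>

lemma is_tree_iff_bridges:
  "is_tree V E \<longleftrightarrow>
     V \<noteq> {} \<and> E \<subseteq> {{i, j} | i j. i \<in> V \<and> j \<in> V \<and> i \<noteq> j} \<and>
     (\<forall>i\<in>V. \<forall>j\<in>V. (i, j) \<in> (adj E)\<^sup>*) \<and>
     (\<forall>i j. {i, j} \<in> E \<longrightarrow> (i, j) \<notin> (adj (E - {{i, j}}))\<^sup>*)"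
proof -
  have "(\<exists>vs. length vs \<ge> 3 \<and> distinct vs \<and>
          (\<forall>k < length vs. {vs ! k, vs ! (Suc k mod length vs)} \<in> E)) \<longleftrightarrow>
        (\<exists>i j. {i, j} \<in> E \<and> (i, j) \<in> (adj (E - {{i, j}}))\<^sup>*)"
    (is "?cycle \<longleftrightarrow> ?nobridge")
    if edges: "E \<subseteq> {{i, j} | i j. i \<in> V \<and> j \<in> V \<and> i \<noteq> j}"
  proof
    assume ?cycle
    then obtain vs where vs: "length vs \<ge> 3" "distinct vs"
      and cyc: "\<And>k. k < length vs \<Longrightarrow> {vs ! k, vs ! (Suc k mod length vs)} \<in> E"
      by blast
    define m where "m = length vs - 1"
    have m: "length vs = Suc m" "m \<ge> 2"
      using vs(1) by (auto simp: m_def)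
    \<comment> \<open>The closing edge of the cycle is removed; the rest of the cycle is the detour
      around it.\<close>
    let ?R = "adj (E - {{vs ! 0, vs ! m}})"
    have "(vs ! 0, vs ! k) \<in> ?R\<^sup>*" if "k \<le> m" for k
      using that
    proof (induction k)
      case (Suc k)
      have "{vs ! k, vs ! Suc k} \<in> E"
        using cyc [of k] Suc.prems m by simp
      \<comment> \<open>Here \<open>m \<ge> 2\<close> matters: for \<open>m = 1\<close> the closing
        edge would be the first edge itself.\<close>
      moreover have "{vs ! k, vs ! Suc k} \<noteq> {vs ! 0, vs ! m}"
        using vs(2) m Suc.prems by (auto simp: doubleton_eq_iff nth_eq_iff_index_eq)
      ultimately have "(vs ! k, vs ! Suc k) \<in> ?R"
        by (simp add: adj_iff)
      then show ?case
        using Suc by (meson Suc_leD rtrancl.rtrancl_into_rtrancl)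
    qed simp
    moreover have "{vs ! 0, vs ! m} \<in> E"
      using cyc [of m] m by (simp add: insert_commute)
    ultimately show ?nobridge
      by blast
  next
    assume ?nobridge
    then obtain i j where ij: "{i, j} \<in> E" "(i, j) \<in> (adj (E - {{i, j}}))\<^sup>*"
      by blast
    \<comment> \<open>A loop would have the empty walk as a detour without giving a cycle;
      \<open>edges\<close> excludes loops.\<close>
    have "i \<noteq> j"
      using ij(1) edges by (auto simp: doubleton_eq_iff)
    from ij(2) obtain vs where vs: "distinct (i # vs)" "last (i # vs) = j"
      "\<forall>k < length vs. ((i # vs) ! k, vs ! k) \<in> adj (E - {{i, j}})"
      by (rule rtrancl_distinct_list)
    have "vs \<noteq> []"
      using vs(2) \<open>i \<noteq> j\<close> by auto
    \<comment> \<open>A detour of one step would be the removed edge, so the cycle has at least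
      three vertices.\<close>
    have "length vs \<noteq> 1"
    proof
      assume "length vs = 1"
      then have "vs = [j]"
        using vs(2) by (cases vs) auto
      with vs(3) [rule_format, of 0] show False
        by (simp add: adj_iff)
    qed
    with \<open>vs \<noteq> []\<close> have len: "length (i # vs) \<ge> 3"
      by (cases vs) (auto simp: Suc_le_eq)
    have "{(i # vs) ! k, (i # vs) ! (Suc k mod length (i # vs))} \<in> E"
      if "k < length (i # vs)" for k
    proof (cases "k = length vs")
      case True
      then have "(i # vs) ! k = j"
        using vs(2) last_conv_nth [of "i # vs"] by simp
      then show ?thesis
        using True ij(1) by (simp add: insert_commute)
    next
      case False
      then have "k < length vs"
        using that by simp
      with vs(3) [rule_format, of k] show ?thesis
        by (simp add: adj_iff)
    qed
    with len vs(1) show ?cycle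
      by blast
  qed
  then show ?thesis
    unfolding is_tree_def adj_def [symmetric] by blast
qed

lemma is_treeD:
  assumes "is_tree V E"
  shows "\<And>x y. {x, y} \<in> E \<Longrightarrow> x \<in> V \<and> y \<in> V \<and> x \<noteq> y"
    and "\<And>e. e \<in> E \<Longrightarrow> \<exists>x y. e = {x, y} \<and> x \<in> V \<and> y \<in> V \<and> x \<noteq> y"
    and "\<And>x y. x \<in> V \<Longrightarrow> y \<in> V \<Longrightarrow> (x, y) \<in> (adj E)\<^sup>*"
    and "\<And>x y. {x, y} \<in> E \<Longrightarrow> (x, y) \<notin> (adj (E - {{x, y}}))\<^sup>*"
proof -
  have *: "E \<subseteq> {{i, j} | i j. i \<in> V \<and> j \<in> V \<and> i \<noteq> j}"
    using assms by (simp add: is_tree_iff_bridges)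
  show "x \<in> V \<and> y \<in> V \<and> x \<noteq> y" if "{x, y} \<in> E" for x y
    using that * by (auto simp: doubleton_eq_iff)
  show "\<exists>x y. e = {x, y} \<and> x \<in> V \<and> y \<in> V \<and> x \<noteq> y" if "e \<in> E" for e
    using that * by blast
qed (use assms in \<open>auto simp: is_tree_iff_bridges\<close>)

lemma is_treeI:
  assumes "V \<noteq> {}"
    and "\<And>e. e \<in> E \<Longrightarrow> \<exists>x y. e = {x, y} \<and> x \<in> V \<and> y \<in> V \<and> x \<noteq> y"
    and "\<And>x y. x \<in> V \<Longrightarrow> y \<in> V \<Longrightarrow> (x, y) \<in> (adj E)\<^sup>*"
    and "\<And>x y. {x, y} \<in> E \<Longrightarrow> (x, y) \<notin> (adj (E - {{x, y}}))\<^sup>*"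
  shows "is_tree V E"
  using assms unfolding is_tree_iff_bridges by blast

text \<open>
  Contracting the edge \<open>{i, v}\<close> of a tree into \<open>i\<close> gives a tree without the vertex \<open>v\<close>; the
  contracted tree together with the set \<open>S\<close> of former neighbours of \<open>v\<close> determines the tree.
\<close>

definition expand_vertex :: "'v set set \<Rightarrow> 'v \<Rightarrow> 'v \<Rightarrow> 'v set \<Rightarrow> 'v set set" where
  "expand_vertex T i v S = (T - (\<lambda>j. {i, j}) ` S) \<union> (\<lambda>j. {v, j}) ` insert i S"

definition contract_edge :: "'v set set \<Rightarrow> 'v \<Rightarrow> 'v \<Rightarrow> 'v set set" where
  "contract_edge E i v = {e \<in> E. v \<notin> e} \<union> (\<lambda>j. {i, j}) ` (nbrs E v - {i})"

lemma edge_sets_eqI: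
  assumes "\<And>x y. {x, y} \<in> A \<longleftrightarrow> {x, y} \<in> B"
    and "\<And>e. e \<in> A \<or> e \<in> B \<Longrightarrow> \<exists>x y. e = {x, y}"
  shows "A = B"
  using assms by (metis subsetI subset_antisym)

lemma edge_commute: "{x, y} \<in> E \<longleftrightarrow> {y, x} \<in> E"
  by (simp add: insert_commute)

lemma star_iff: "{x, y} \<in> (\<lambda>j. {i, j}) ` A \<longleftrightarrow> x = i \<and> y \<in> A \<or> y = i \<and> x \<in> A"
  by (auto simp: doubleton_eq_iff image_iff)

lemma expand_vertex_iff:
  "{x, y} \<in> expand_vertex T i v S \<longleftrightarrow>
     ({x, y} \<in> T \<and> \<not> (x = i \<and> y \<in> S) \<and> \<not> (y = i \<and> x \<in> S)) \<or>
     (x = v \<and> y \<in> insert i S) \<or> (y = v \<and> x \<in> insert i S)"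
  unfolding expand_vertex_def Un_iff Diff_iff star_iff by blast

lemma contract_edge_iff:
  "{x, y} \<in> contract_edge E i v \<longleftrightarrow>
     ({x, y} \<in> E \<and> x \<noteq> v \<and> y \<noteq> v) \<or>
     (x = i \<and> {v, y} \<in> E \<and> y \<noteq> i) \<or> (y = i \<and> {v, x} \<in> E \<and> x \<noteq> i)"
  unfolding contract_edge_def Un_iff star_iff nbrs_def by auto

lemma adj_two_steps:
  assumes "{x, y} \<in> E" "{y, z} \<in> E"
  shows "(x, z) \<in> (adj E)\<^sup>*"
  using assms by (meson adj_iff converse_rtrancl_into_rtrancl r_into_rtrancl)

lemma adj_one_step: "{x, y} \<in> E \<Longrightarrow> (x, y) \<in> (adj E)\<^sup>*"
  by (simp add: adj_iff r_into_rtrancl)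

section \<open>Expanding a vertex of a tree into an edge\<close>

context
  fixes V :: "'v set" and T :: "'v set set" and i v :: 'v and S :: "'v set"
  assumes tree: "is_tree V T" and iV: "i \<in> V" and vV: "v \<notin> V" and S: "S \<subseteq> nbrs T i"
begin

lemma expand_vertex_no_v: "{v, y} \<notin> T" "{y, v} \<notin> T"
  using is_treeD(1) [OF tree] vV by blast+

lemma expand_vertex_S: "j \<in> S \<Longrightarrow> {i, j} \<in> T \<and> {j, i} \<in> T \<and> j \<in> V \<and> j \<noteq> i \<and> j \<noteq> v"
  using S is_treeD(1) [OF tree, of i j] vV by (auto simp: nbrs_def insert_commute)

lemma expand_vertex_connected:
  assumes "x \<in> insert v V" "y \<in> insert v V"
  shows "(x, y) \<in> (adj (expand_vertex T i v S))\<^sup>*"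
proof -
  let ?E = "expand_vertex T i v S"
  have V: "(x, y) \<in> (adj ?E)\<^sup>*" if "x \<in> V" "y \<in> V" for x y
  proof (rule rtrancl_map [where f = "\<lambda>x. x"])
    show "(x, y) \<in> (adj T)\<^sup>*"
      using is_treeD(3) [OF tree] that by blast
    fix a b
    assume "(a, b) \<in> adj T"
    then have ab: "{a, b} \<in> T"
      by (simp add: adj_iff)
    show "(a, b) \<in> (adj ?E)\<^sup>*"
    proof (cases "{a, b} \<in> ?E")
      case False
      then have "a = i \<and> b \<in> S \<or> b = i \<and> a \<in> S"
        using ab by (auto simp: expand_vertex_iff)
      then show ?thesis
        by (auto intro!: adj_two_steps [where y = v] simp: expand_vertex_iff)
    qed (rule adj_one_step)
  qed
  have v: "(v, x) \<in> (adj ?E)\<^sup>*" if "x \<in> V" for x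
    using V [OF iV that] adj_one_step [of v i ?E]
    by (auto simp: expand_vertex_iff intro: rtrancl_trans)
  show ?thesis
    using assms V v adj_rtrancl_sym by fastforce
qed

text \<open>Merging \<open>v\<close> back into \<open>i\<close> turns a detour around an edge into a
  detour in \<open>T\<close>, which has none. The edge \<open>{i, v}\<close> collapses under this
  map and needs an argument of its own.\<close>

lemma expand_vertex_bridge:
  assumes xy: "{x, y} \<in> expand_vertex T i v S"
  shows "(x, y) \<notin> (adj (expand_vertex T i v S - {{x, y}}))\<^sup>*"
proof
  let ?E = "expand_vertex T i v S"
  assume path: "(x, y) \<in> (adj (?E - {{x, y}}))\<^sup>*"
  show False
  proof (cases "{x, y} = {i, v}")
    case True
    then have "(i, v) \<in> (adj (?E - {{i, v}}))\<^sup>*"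
      using path adj_rtrancl_sym by (auto simp: doubleton_eq_iff insert_commute)
    \<comment> \<open>Invariant of walks from \<open>i\<close> that avoid \<open>{i, v}\<close>:
      they stay inside \<open>T\<close> without the edges removed by the expansion. Entering
      \<open>v\<close> would require some \<open>a\<close> in \<open>S\<close> reached from
      \<open>i\<close> without the edge \<open>{i, a}\<close>, which is a bridge of
      \<open>T\<close>.\<close>
    moreover have "a \<noteq> v \<and> (i, a) \<in> (adj (T - (\<lambda>j. {i, j}) ` S))\<^sup>*"
      if "(i, a) \<in> (adj (?E - {{i, v}}))\<^sup>*" for a
      using that
    proof induction
      case base
      then show ?case using iV vV by auto
    next
      case (step a b)
      have ab: "{a, b} \<in> ?E" "{a, b} \<noteq> {i, v}"
        using step.hyps by (auto simp: adj_iff)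
      have "b \<noteq> v"
      proof
        assume "b = v"
        then have "a \<in> S"
          using ab expand_vertex_no_v step.IH by (auto simp: expand_vertex_iff)
        have "(i, a) \<in> (adj (T - {{i, a}}))\<^sup>*"
          by (rule rtrancl_map [where f = "\<lambda>x. x", OF conjunct2 [OF step.IH]])
            (use \<open>a \<in> S\<close> in \<open>auto simp: adj_iff intro!: adj_one_step\<close>)
        then show False
          using expand_vertex_S [OF \<open>a \<in> S\<close>] is_treeD(4) [OF tree] by blast
      qed
      moreover have "{a, b} \<in> T - (\<lambda>j. {i, j}) ` S"
        using ab(1) step.IH \<open>b \<noteq> v\<close> by (auto simp: expand_vertex_iff doubleton_eq_iff)
      ultimately show ?case
        using step.IH by (meson adj_iff rtrancl.rtrancl_into_rtrancl)
    qed
    ultimately show False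
      by blast
  next
    case False
    define c where "c = (\<lambda>x. if x = v then i else x)"
    have "(c x, c y) \<in> (adj (T - {{c x, c y}}))\<^sup>*"
    proof (rule rtrancl_map [OF path])
      fix a b
      assume "(a, b) \<in> adj (?E - {{x, y}})"
      then have ab: "{a, b} \<in> ?E" "{a, b} \<noteq> {x, y}"
        by (auto simp: adj_iff)
      show "(c a, c b) \<in> (adj (T - {{c x, c y}}))\<^sup>*"
      proof (cases "{a, b} = {i, v}")
        case True
        then have "c a = c b"
          by (auto simp: c_def doubleton_eq_iff)
        then show ?thesis by simp
      next
        case ne: False
        have "{c a, c b} \<in> T"
          using ab(1) ne expand_vertex_S expand_vertex_no_v
          by (auto simp: c_def expand_vertex_iff)
        \<comment> \<open>Apart from \<open>{i, v}\<close>, distinct edges keep distinct images: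
          \<open>{v, j}\<close> with \<open>j\<close> in \<open>S\<close> goes to
          \<open>{i, j}\<close>, which the expansion has removed.\<close>
        moreover have "{c a, c b} \<noteq> {c x, c y}"
          using ab ne xy False expand_vertex_S expand_vertex_no_v iV vV
          unfolding c_def expand_vertex_iff doubleton_eq_iff
          by (smt (verit) insert_iff)
        ultimately show ?thesis
          by (intro adj_one_step) simp
      qed
    qed
    moreover have "{c x, c y} \<in> T"
      using xy False expand_vertex_S expand_vertex_no_v
      by (auto simp: c_def expand_vertex_iff)
    ultimately show False
      using is_treeD(4) [OF tree] by blast
  qed
qed

lemma is_tree_expand_vertex: "is_tree (insert v V) (expand_vertex T i v S)"
proof (rule is_treeI)
  fix e
  assume "e \<in> expand_vertex T i v S"
  then consider "e \<in> T" | j where "j \<in> insert i S" "e = {v, j}"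
    by (auto simp: expand_vertex_def)
  then show "\<exists>x y. e = {x, y} \<and> x \<in> insert v V \<and> y \<in> insert v V \<and> x \<noteq> y"
    using is_treeD(2) [OF tree, of e] expand_vertex_S iV vV by cases (blast, fastforce)
qed (use expand_vertex_connected expand_vertex_bridge in auto)

lemma nbrs_expand_vertex: "nbrs (expand_vertex T i v S) v - {i} = S"
  using expand_vertex_S expand_vertex_no_v iV vV
  by (auto simp: nbrs_def expand_vertex_iff)

lemma contract_expand_vertex: "contract_edge (expand_vertex T i v S) i v = T"
proof (rule edge_sets_eqI)
  fix x y
  show "{x, y} \<in> contract_edge (expand_vertex T i v S) i v \<longleftrightarrow> {x, y} \<in> T"
    unfolding contract_edge_iff expand_vertex_iff
    using expand_vertex_S expand_vertex_no_v iV vV is_treeD(1) [OF tree, of x y]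
    by auto
next
  fix e
  assume "e \<in> contract_edge (expand_vertex T i v S) i v \<or> e \<in> T"
  then show "\<exists>x y. e = {x, y}"
    using is_treeD(2) [OF tree, of e] by (auto simp: contract_edge_def expand_vertex_def)
qed

text \<open>Identifies the factors that survive when the neighbours in \<open>S\<close> are handed
  over to \<open>v\<close>: the edges away from \<open>i\<close>, and those from \<open>i\<close> to
  the neighbours it keeps.\<close>

lemma expand_vertex_old_edges:
  "{e \<in> expand_vertex T i v S. v \<notin> e} = {e \<in> T. i \<notin> e} \<union> (\<lambda>j. {i, j}) ` (nbrs T i - S)"
    (is "?L = ?R")
proof (rule edge_sets_eqI)
  fix x y
  show "{x, y} \<in> ?L \<longleftrightarrow> {x, y} \<in> ?R"
    using expand_vertex_S expand_vertex_no_v iV vV is_treeD(1) [OF tree, of x y]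
      insert_commute [of x y "{}"]
    unfolding Un_iff star_iff mem_Collect_eq expand_vertex_iff nbrs_def by auto
next
  fix e
  assume "e \<in> ?L \<or> e \<in> ?R"
  then show "\<exists>x y. e = {x, y}"
    using is_treeD(2) [OF tree, of e] by (auto simp: expand_vertex_def)
qed

end

section \<open>Contracting an edge of a tree\<close>

context
  fixes V :: "'v set" and E :: "'v set set" and i v :: 'v
  assumes tree: "is_tree (insert v V) E" and iV: "i \<in> V" and vV: "v \<notin> V" and iv: "{i, v} \<in> E"
begin

lemma contract_edge_facts:
  "{v, i} \<in> E" "{v, v} \<notin> E" "i \<noteq> v"
  using iv is_treeD(1) [OF tree, of i v] is_treeD(1) [OF tree, of v v]
  by (auto simp: insert_commute)

text \<open>The walk through \<open>v\<close> would be a detour around \<open>{i, j}\<close>. Hence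
  contraction never merges a moved edge with an existing one, and
  \<open>expand_contract_edge\<close> can recover \<open>E\<close>.\<close>

lemma no_triangle:
  assumes "{v, j} \<in> E" "j \<noteq> i"
  shows "{i, j} \<notin> E"
proof
  assume "{i, j} \<in> E"
  moreover have "(i, j) \<in> (adj (E - {{i, j}}))\<^sup>*"
    using assms iv contract_edge_facts
    by (intro adj_two_steps [where y = v]) (auto simp: doubleton_eq_iff)
  ultimately show False
    using is_treeD(4) [OF tree] by blast
qed

text \<open>Walks of the contracted graph lift to \<open>E\<close> by replacing a new edge
  \<open>{i, b}\<close> with the two steps from \<open>i\<close> over \<open>v\<close> to
  \<open>b\<close>. Old and new edges are treated separately.\<close>

lemma contract_edge_bridge:
  assumes xy: "{x, y} \<in> contract_edge E i v"
  shows "(x, y) \<notin> (adj (contract_edge E i v - {{x, y}}))\<^sup>*"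
proof
  let ?T = "contract_edge E i v"
  assume path: "(x, y) \<in> (adj (?T - {{x, y}}))\<^sup>*"
  \<comment> \<open>New edges: a detour around \<open>{i, j}\<close> lifts to a walk from
    \<open>i\<close> to \<open>j\<close> that avoids \<open>{v, j}\<close>; preceded by the step
    from \<open>v\<close> to \<open>i\<close> it is a detour around \<open>{v, j}\<close> in
    \<open>E\<close>.\<close>
  have *: False if j: "{v, j} \<in> E" "j \<noteq> i" and path: "(i, j) \<in> (adj (?T - {{i, j}}))\<^sup>*" for j
  proof -
    have "(i, j) \<in> (adj (E - {{v, j}}))\<^sup>*"
    proof (rule rtrancl_map [where f = "\<lambda>x. x", OF path])
      fix a b
      assume "(a, b) \<in> adj (?T - {{i, j}})"
      then have "{a, b} \<in> ?T" "{a, b} \<noteq> {i, j}"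
        by (auto simp: adj_iff)
      then consider "{a, b} \<in> E" "a \<noteq> v" "b \<noteq> v"
        | "a = i" "{v, b} \<in> E" "b \<noteq> j" | "b = i" "{v, a} \<in> E" "a \<noteq> j"
        by (auto simp: contract_edge_iff insert_commute)
      then show "(a, b) \<in> (adj (E - {{v, j}}))\<^sup>*"
      proof cases
        case 1
        then show ?thesis by (intro adj_one_step) (auto simp: doubleton_eq_iff)
      next
        case 2
        then show ?thesis using iv contract_edge_facts j
          by (intro adj_two_steps [where y = v]) (auto simp: doubleton_eq_iff)
      next
        case 3
        then show ?thesis using iv contract_edge_facts j
          by (intro adj_two_steps [where y = v]) (auto simp: doubleton_eq_iff insert_commute)
      qed
    qed
    moreover have "(v, i) \<in> (adj (E - {{v, j}}))\<^sup>*"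
      using contract_edge_facts j by (intro adj_one_step) (auto simp: doubleton_eq_iff)
    ultimately show False
      using is_treeD(4) [OF tree j(1)] by (meson rtrancl_trans)
  qed
  consider "{x, y} \<in> E" "x \<noteq> v" "y \<noteq> v"
    | "x = i" "{v, y} \<in> E" "y \<noteq> i" | "y = i" "{v, x} \<in> E" "x \<noteq> i"
    using xy by (auto simp: contract_edge_iff)
  then show False
  proof cases
    case 1
    have "(x, y) \<in> (adj (E - {{x, y}}))\<^sup>*"
    proof (rule rtrancl_map [where f = "\<lambda>x. x", OF path])
      fix a b
      assume "(a, b) \<in> adj (?T - {{x, y}})"
      then have ab: "{a, b} \<in> ?T" "{a, b} \<noteq> {x, y}"
        by (auto simp: adj_iff)
      then show "(a, b) \<in> (adj (E - {{x, y}}))\<^sup>*"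
      proof (cases "{a, b} \<in> E")
        case True
        then show ?thesis using ab by (intro adj_one_step) auto
      next
        case False
        then have "a = i \<and> {v, b} \<in> E \<or> b = i \<and> {v, a} \<in> E"
          using ab by (auto simp: contract_edge_iff)
        then show ?thesis using iv contract_edge_facts 1
          by (intro adj_two_steps [where y = v]) (auto simp: doubleton_eq_iff insert_commute)
      qed
    qed
    then show False
      using is_treeD(4) [OF tree] 1 by blast
  next
    case 2
    then show False using * path by blast
  next
    case 3
    then show False using * [of x] adj_rtrancl_sym [OF path] by (simp add: insert_commute)
  qed
qed

lemma is_tree_contract_edge: "is_tree V (contract_edge E i v)"
proof (rule is_treeI)
  fix e
  assume "e \<in> contract_edge E i v"
  then consider "e \<in> E" "v \<notin> e" | j where "e = {i, j}" "{v, j} \<in> E" "j \<noteq> i"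
    by (auto simp: contract_edge_def nbrs_def)
  then show "\<exists>x y. e = {x, y} \<and> x \<in> V \<and> y \<in> V \<and> x \<noteq> y"
  proof cases
    case 1
    then show ?thesis using is_treeD(2) [OF tree, of e] by blast
  next
    case 2
    then have "j \<in> V" using is_treeD(1) [OF tree, of v j] by auto
    then show ?thesis using 2 iV by blast
  qed
next
  \<comment> \<open>Walks in \<open>E\<close> may pass through \<open>v\<close>; merging
    \<open>v\<close> into \<open>i\<close> sends them to walks in the contracted graph.\<close>
  define c where "c = (\<lambda>x. if x = v then i else x)"
  fix x y
  assume "x \<in> V" "y \<in> V"
  then have "c x = x" "c y = y"
    using vV by (auto simp: c_def)
  moreover have "(c x, c y) \<in> (adj (contract_edge E i v))\<^sup>*"
  proof (rule rtrancl_map [where f = c])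
    show "(x, y) \<in> (adj E)\<^sup>*"
      using is_treeD(3) [OF tree] \<open>x \<in> V\<close> \<open>y \<in> V\<close> by blast
    fix a b
    assume "(a, b) \<in> adj E"
    then have ab: "{a, b} \<in> E"
      by (simp add: adj_iff)
    show "(c a, c b) \<in> (adj (contract_edge E i v))\<^sup>*"
    proof (cases "c a = c b")
      case False
      then have "{c a, c b} \<in> contract_edge E i v"
        using ab by (auto simp: contract_edge_iff c_def insert_commute split: if_splits)
      then show ?thesis by (rule adj_one_step)
    qed simp
  qed
  ultimately show "(x, y) \<in> (adj (contract_edge E i v))\<^sup>*"
    by simp
qed (use contract_edge_bridge iV in auto)

lemma nbrs_contract_edge: "nbrs E v - {i} \<subseteq> nbrs (contract_edge E i v) i"
  by (auto simp: nbrs_def contract_edge_iff)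

lemma expand_contract_edge: "expand_vertex (contract_edge E i v) i v (nbrs E v - {i}) = E"
proof (rule edge_sets_eqI)
  fix x y
  show "{x, y} \<in> expand_vertex (contract_edge E i v) i v (nbrs E v - {i}) \<longleftrightarrow> {x, y} \<in> E"
    unfolding contract_edge_iff expand_vertex_iff nbrs_def
    using contract_edge_facts iv no_triangle [of x] no_triangle [of y]
      edge_commute [of x v E] edge_commute [of y v E] edge_commute [of x i E] edge_commute [of y i E]
    by auto
next
  fix e
  assume "e \<in> expand_vertex (contract_edge E i v) i v (nbrs E v - {i}) \<or> e \<in> E"
  then show "\<exists>x y. e = {x, y}"
    using is_treeD(2) [OF tree, of e] by (auto simp: contract_edge_def expand_vertex_def)
qed

end

section \<open>Products over edges and sums over trees\<close>

lemma finite_is_tree: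
  assumes "is_tree V E" "finite V"
  shows "finite E" "finite (nbrs E x)"
proof -
  have "E \<subseteq> Pow V"
    using is_treeD(2) [OF assms(1)] by blast
  then show "finite E"
    using assms(2) finite_subset by blast
  have "nbrs E x \<subseteq> V"
    using is_treeD(1) [OF assms(1)] by (auto simp: nbrs_def)
  then show "finite (nbrs E x)"
    using assms(2) finite_subset by blast
qed

lemma finite_trees_on: "finite V \<Longrightarrow> finite {E. is_tree V E}"
  by (rule finite_subset [where B = "Pow (Pow V)"]) (auto dest: is_treeD(2))

lemma prod_edges_at:
  fixes h :: "'v set \<Rightarrow> 'b :: comm_monoid_mult"
  assumes "is_tree V E" "finite V"
  shows "(\<Prod>e\<in>E. h e) = (\<Prod>e | e \<in> E \<and> i \<notin> e. h e) * (\<Prod>j\<in>nbrs E i. h {i, j})"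
proof -
  have E: "E = {e \<in> E. i \<notin> e} \<union> (\<lambda>j. {i, j}) ` nbrs E i"
    using is_treeD(2) [OF assms(1)] by (fastforce simp: nbrs_def insert_commute)
  have "(\<Prod>e\<in>E. h e) = (\<Prod>e | e \<in> E \<and> i \<notin> e. h e) * (\<Prod>e\<in>(\<lambda>j. {i, j}) ` nbrs E i. h e)"
    by (subst E, rule prod.union_disjoint) (use finite_is_tree [OF assms] in auto)
  also have "(\<Prod>e\<in>(\<lambda>j. {i, j}) ` nbrs E i. h e) = (\<Prod>j\<in>nbrs E i. h {i, j})"
    by (subst prod.reindex) (auto simp: inj_on_def doubleton_eq_iff)
  finally show ?thesis .
qed

text \<open>Multiplying out the product over the neighbours of \<open>i\<close> chooses a set
  \<open>S\<close> of neighbours that contribute \<open>g\<close>; their edges are moved to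
  \<open>v\<close>. The pairs of a tree and such a set correspond bijectively, by expansion and
  contraction, to the trees on the larger vertex set that contain \<open>{i, v}\<close>.\<close>

lemma sum_trees_contract:
  fixes h :: "'v set \<Rightarrow> 'b :: comm_ring_1" and g :: "'v \<Rightarrow> 'b"
  assumes V: "finite V" and i: "i \<in> V" and v: "v \<notin> V"
  shows "(\<Sum>T | is_tree V T. (\<Prod>e | e \<in> T \<and> i \<notin> e. h e) * (\<Prod>j\<in>nbrs T i. h {i, j} + g j)) =
    (\<Sum>E | is_tree (insert v V) E \<and> i \<in> nbrs E v.
       (\<Prod>e | e \<in> E \<and> v \<notin> e. h e) * (\<Prod>j\<in>nbrs E v - {i}. g j))"
    (is "?L = ?R")
proof -
  have *: "(\<Prod>e | e \<in> T \<and> i \<notin> e. h e) * (\<Prod>j\<in>nbrs T i. h {i, j} + g j) =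
      (\<Sum>S\<in>Pow (nbrs T i). (\<Prod>e | e \<in> expand_vertex T i v S \<and> v \<notin> e. h e) * (\<Prod>j\<in>S. g j))"
    if T: "is_tree V T" for T
  proof -
    have fin: "finite T" "finite (nbrs T i)"
      using finite_is_tree [OF T V] by auto
    have "(\<Prod>e | e \<in> expand_vertex T i v S \<and> v \<notin> e. h e) =
        (\<Prod>e | e \<in> T \<and> i \<notin> e. h e) * (\<Prod>j\<in>nbrs T i - S. h {i, j})"
      if "S \<subseteq> nbrs T i" for S
    proof -
      have "(\<Prod>e | e \<in> expand_vertex T i v S \<and> v \<notin> e. h e) =
          (\<Prod>e | e \<in> T \<and> i \<notin> e. h e) * (\<Prod>e\<in>(\<lambda>j. {i, j}) ` (nbrs T i - S). h e)"
        unfolding expand_vertex_old_edges [OF T i v that]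
        by (rule prod.union_disjoint) (use fin in auto)
      also have "(\<Prod>e\<in>(\<lambda>j. {i, j}) ` (nbrs T i - S). h e) = (\<Prod>j\<in>nbrs T i - S. h {i, j})"
        by (subst prod.reindex) (auto simp: inj_on_def doubleton_eq_iff)
      finally show ?thesis .
    qed
    then show ?thesis
      using prod_add [OF fin(2), of g "\<lambda>j. h {i, j}"]
      by (simp add: add.commute sum_distrib_left mult_ac)
  qed
  have "?L = (\<Sum>(T, S)\<in>(SIGMA T:{T. is_tree V T}. Pow (nbrs T i)).
      (\<Prod>e | e \<in> expand_vertex T i v S \<and> v \<notin> e. h e) * (\<Prod>j\<in>S. g j))"
    by (subst sum.Sigma [symmetric])
      (use finite_trees_on [OF V] finite_is_tree [OF _ V] * in auto)
  also have "\<dots> = ?R"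
  proof (rule sum.reindex_bij_witness
      [where i = "\<lambda>E. (contract_edge E i v, nbrs E v - {i})"
        and j = "\<lambda>(T, S). expand_vertex T i v S"], goal_cases)
    case (1 p)
    obtain T S where p: "p = (T, S)" "is_tree V T" "S \<subseteq> nbrs T i"
      using 1 by auto
    then show ?case
      by (simp add: contract_expand_vertex [OF p(2) i v p(3)] nbrs_expand_vertex [OF p(2) i v p(3)])
  next
    case (2 p)
    obtain T S where p: "p = (T, S)" "is_tree V T" "S \<subseteq> nbrs T i"
      using 2 by auto
    then show ?case
      using is_tree_expand_vertex [OF p(2) i v p(3)] by (simp add: nbrs_def expand_vertex_iff)
  next
    case (3 E)
    then have "is_tree (insert v V) E" "{i, v} \<in> E"
      by (auto simp: nbrs_def insert_commute)
    from expand_contract_edge [OF this(1) i v this(2)] show ?case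
      by simp
  next
    case (4 E)
    then have "is_tree (insert v V) E" "{i, v} \<in> E"
      by (auto simp: nbrs_def insert_commute)
    from is_tree_contract_edge [OF this(1) i v this(2)] nbrs_contract_edge [OF this(1) i v this(2)]
    show ?case
      by simp
  next
    case (5 p)
    obtain T S where p: "p = (T, S)" "is_tree V T" "S \<subseteq> nbrs T i"
      using 5 by auto
    then show ?case
      by (simp add: nbrs_expand_vertex [OF p(2) i v p(3)])
  qed
  finally show ?thesis .
qed

section \<open>The recursion for weighted tree sums\<close>

text \<open>Induction on the set of poles. The point \<open>x\<close> is kept arbitrary because the
  induction hypothesis is used at \<open>x\<close> and again at the new pole
  \<open>z k\<close>.\<close>

lemma partial_fractions:
  fixes z :: "'a \<Rightarrow> 'b :: field"
  assumes "finite M" "M \<noteq> {}" "inj_on z M" "x \<notin> z ` M"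
  shows "(\<Prod>j\<in>M. 1 / (x - z j)) = (\<Sum>i\<in>M. 1 / (x - z i) * (\<Prod>j\<in>M - {i}. 1 / (z i - z j)))"
  using assms
proof (induction M arbitrary: x rule: finite_ne_induct)
  case (singleton k)
  then show ?case by simp
next
  case (insert k M)
  define P where "P = (\<lambda>i. \<Prod>j\<in>M - {i}. 1 / (z i - z j))"
  have inj: "inj_on z M" and zk: "z k \<notin> z ` M"
    using insert.prems insert.hyps by auto
  have x: "x \<noteq> z k" "x \<notin> z ` M"
    using insert.prems by auto
  have prod_insert: "(\<Prod>j\<in>insert k M - {i}. 1 / (z i - z j)) = 1 / (z i - z k) * P i"
    if "i \<in> M" for i
  proof -
    have "insert k M - {i} = insert k (M - {i})"
      using that insert.hyps by auto
    then show ?thesis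
      using insert.hyps by (simp add: P_def)
  qed
  \<comment> \<open>The decomposition for the two poles \<open>z i\<close> and \<open>z k\<close>,
    multiplied by \<open>P i\<close>.\<close>
  have split: "1 / (x - z k) * (1 / (x - z i) * P i) =
      1 / (x - z i) * (1 / (z i - z k) * P i) + 1 / (x - z k) * (1 / (z k - z i) * P i)"
    if "i \<in> M" for i
  proof -
    have "x \<noteq> z i" "z k \<noteq> z i"
      using that x zk by (metis imageI)+
    then have "x - z i \<noteq> 0" "z k - z i \<noteq> 0" "z i - z k \<noteq> 0" "x - z k \<noteq> 0"
      using x by auto
    then have "1 / (x - z k) * (1 / (x - z i)) =
        1 / (x - z i) * (1 / (z i - z k)) + 1 / (x - z k) * (1 / (z k - z i))"
      by (simp add: divide_simps) (simp add: algebra_simps)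
    then show ?thesis
      by (metis (no_types, lifting) distrib_right mult.assoc)
  qed
  have "(\<Prod>j\<in>insert k M. 1 / (x - z j)) = 1 / (x - z k) * (\<Prod>j\<in>M. 1 / (x - z j))"
    using insert.hyps by simp
  also have "\<dots> = (\<Sum>i\<in>M. 1 / (x - z k) * (1 / (x - z i) * P i))"
    using insert.IH [OF inj x(2)] by (simp add: P_def sum_distrib_left)
  also have "\<dots> = (\<Sum>i\<in>M. 1 / (x - z i) * (1 / (z i - z k) * P i)) +
      1 / (x - z k) * (\<Sum>i\<in>M. 1 / (z k - z i) * P i)"
    by (simp only: sum.distrib [symmetric] sum_distrib_left) (intro sum.cong refl split)
  \<comment> \<open>The second use of the induction hypothesis, at \<open>z k\<close>, yields the
    coefficient of the new pole.\<close>
  also have "(\<Sum>i\<in>M. 1 / (z k - z i) * P i) = (\<Prod>j\<in>M. 1 / (z k - z j))"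
    using insert.IH [OF inj zk] by (simp add: P_def)
  also have "(\<Sum>i\<in>M. 1 / (x - z i) * (1 / (z i - z k) * P i)) + 1 / (x - z k) * \<dots> =
      (\<Sum>i\<in>insert k M. 1 / (x - z i) * (\<Prod>j\<in>insert k M - {i}. 1 / (z i - z j)))"
    using insert.hyps prod_insert by (simp add: add.commute mult.commute)
  finally show ?case .
qed

text \<open>Turns a function of ordered pairs into one of edges as sets. Choosing the smaller end
  first matches the orientation in \<open>edge_list\<close>; for symmetric \<open>w\<close> the
  choice is immaterial.\<close>

definition edge_weight :: "(nat \<Rightarrow> nat \<Rightarrow> complex) \<Rightarrow> nat set \<Rightarrow> complex" where
  "edge_weight w e = w (Min e) (Max e)"

lemma edge_weight_doubleton:
  assumes "\<And>i j. w i j = w j i"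
  shows "edge_weight w {i, j} = w i j"
  using assms by (cases i j rule: linorder_cases) (auto simp: edge_weight_def)

text \<open>
  The factor \<open>D\<^sup>i\<^sup>j / z\<^sub>i\<^sub>j\<close> on exponentials whose logarithmic \<open>u\<close>- and \<open>w\<close>-derivatives are
  \<open>a\<close> and \<open>b\<close>.
\<close>

definition weight :: "(nat \<Rightarrow> complex) \<Rightarrow> (nat \<Rightarrow> complex) \<Rightarrow> (nat \<Rightarrow> complex) \<Rightarrow> nat \<Rightarrow> nat \<Rightarrow> complex"
  where "weight z a b i j = (a i * b j - a j * b i) / (z i - z j)"

lemma weight_commute: "weight z a b i j = weight z a b j i"
proof -
  have "weight z a b i j = - (a i * b j - a j * b i) / - (z i - z j)"
    unfolding weight_def by (rule minus_divide_divide [symmetric])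
  then show ?thesis
    by (simp add: weight_def)
qed

lemma edge_weight_weight: "edge_weight (weight z a b) {i, j} = weight z a b i j"
  by (rule edge_weight_doubleton) (rule weight_commute)

lemma trees_Suc_nbrs:
  assumes "E \<in> trees (Suc n)" "n \<ge> 1"
  shows "nbrs E (Suc n) \<noteq> {}" "nbrs E (Suc n) \<subseteq> {1..n}" "finite (nbrs E (Suc n))"
proof -
  have E: "is_tree {1..Suc n} E"
    using assms by (simp add: trees_def)
  have "(Suc n, 1) \<in> (adj E)\<^sup>*"
    using is_treeD(3) [OF E] by auto
  then obtain y where "(Suc n, y) \<in> adj E"
    using assms(2) by (auto elim: converse_rtranclE)
  then show "nbrs E (Suc n) \<noteq> {}"
    by (auto simp: nbrs_def adj_iff)
  show "nbrs E (Suc n) \<subseteq> {1..n}"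
    using is_treeD(1) [OF E] by (fastforce simp: nbrs_def)
  then show "finite (nbrs E (Suc n))"
    by (rule finite_subset) simp
qed

text \<open>
  The replaced factor \<open>{\<phi>\<^sub>i, \<phi>\<^sub>N}\<close> is an exponential with the exponents of \<open>i\<close> and \<open>N\<close> added, so an
  edge at \<open>i\<close> gets the sum of its old weight and a term that stands for an edge moved to \<open>N\<close>.
\<close>

lemma tree_sum_recursion:
  fixes n :: nat and z a b :: "nat \<Rightarrow> complex"
  defines "N \<equiv> Suc n"
  assumes n: "n \<ge> 1" and z: "inj_on z {1..N}"
  shows "(\<Sum>E\<in>trees N. \<Prod>e\<in>E. edge_weight (weight z a b) e) =
    (\<Sum>i = 1..n. weight z a b i N *
       (\<Sum>T\<in>trees n. \<Prod>e\<in>T. edge_weight (weight z (a(i := a i + a N)) (b(i := b i + b N))) e))"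
proof -
  define h where "h = edge_weight (weight z a b)"
  \<comment> \<open>The term of a moved edge: its numerator already belongs to
    \<open>{N, j}\<close>, its denominator is still that of \<open>{i, j}\<close>.\<close>
  define g where "g = (\<lambda>i j. (a N * b j - a j * b N) / (z i - z j))"
  define R where "R = (\<lambda>E. \<Prod>e | e \<in> E \<and> N \<notin> e. h e)"
  have "(\<Sum>E\<in>trees N. \<Prod>e\<in>E. h e) =
      (\<Sum>E\<in>trees N. \<Sum>i\<in>nbrs E N. weight z a b i N * (R E * (\<Prod>j\<in>nbrs E N - {i}. g i j)))"
  proof (rule sum.cong [OF refl])
    fix E
    assume E: "E \<in> trees N"
    define M where "M = nbrs E N"
    have M: "finite M" "M \<noteq> {}" "M \<subseteq> {1..n}"
      using trees_Suc_nbrs [of E n] E n unfolding M_def N_def by auto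
    have zM: "inj_on z M" "z N \<notin> z ` M"
    proof -
      show "inj_on z M"
        by (rule inj_on_subset [OF z]) (use M in \<open>auto simp: N_def\<close>)
      show "z N \<notin> z ` M"
      proof
        assume "z N \<in> z ` M"
        then obtain j where "j \<in> M" "z N = z j" by auto
        then show False
          using inj_onD [OF z, of N j] M by (auto simp: N_def)
      qed
    qed
    have "(\<Prod>j\<in>M. h {N, j}) = (\<Prod>j\<in>M. a N * b j - a j * b N) * (\<Prod>j\<in>M. 1 / (z N - z j))"
      by (simp add: h_def edge_weight_weight weight_def prod.distrib [symmetric])
    also have "\<dots> = (\<Sum>i\<in>M. weight z a b i N * (\<Prod>j\<in>M - {i}. g i j))"
      \<comment> \<open>Only the denominators are decomposed. In the summand of \<open>i\<close>,
        the numerator of \<open>{N, i}\<close> completes the factor \<open>1 / (z N - z i)\<close>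
        to a weight, and the others combine to \<open>g i j\<close>.\<close>
      unfolding partial_fractions [OF M(1,2) zM] sum_distrib_left
    proof (rule sum.cong [OF refl])
      fix i
      assume "i \<in> M"
      then have "(\<Prod>j\<in>M. a N * b j - a j * b N) =
          (a N * b i - a i * b N) * (\<Prod>j\<in>M - {i}. a N * b j - a j * b N)"
        by (rule prod.remove [OF M(1)])
      then show "(\<Prod>j\<in>M. a N * b j - a j * b N) * (1 / (z N - z i) * (\<Prod>j\<in>M - {i}. 1 / (z i - z j))) =
          weight z a b i N * (\<Prod>j\<in>M - {i}. g i j)"
        unfolding weight_commute [of z a b i N]
        by (simp add: weight_def g_def prod_dividef)
    qed
    finally have "(\<Prod>j\<in>M. h {N, j}) = (\<Sum>i\<in>M. weight z a b i N * (\<Prod>j\<in>M - {i}. g i j))" .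
    moreover have "(\<Prod>e\<in>E. h e) = R E * (\<Prod>j\<in>M. h {N, j})"
      unfolding R_def M_def by (rule prod_edges_at [of "{1..N}"]) (use E in \<open>auto simp: trees_def\<close>)
    ultimately show "(\<Prod>e\<in>E. h e) =
        (\<Sum>i\<in>nbrs E N. weight z a b i N * (R E * (\<Prod>j\<in>nbrs E N - {i}. g i j)))"
      by (simp add: M_def [symmetric] sum_distrib_left mult_ac)
  qed
  \<comment> \<open>The inner index set is written as a restriction of \<open>{1..n}\<close>, so
    that the two sums can be exchanged.\<close>
  also have "\<dots> = (\<Sum>E\<in>trees N. \<Sum>i | i \<in> {1..n} \<and> i \<in> nbrs E N.
      weight z a b i N * (R E * (\<Prod>j\<in>nbrs E N - {i}. g i j)))"
    using trees_Suc_nbrs n unfolding N_def by (intro sum.cong refl) blast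
  also have "\<dots> = (\<Sum>i = 1..n. \<Sum>E | E \<in> trees N \<and> i \<in> nbrs E N.
      weight z a b i N * (R E * (\<Prod>j\<in>nbrs E N - {i}. g i j)))"
    by (rule sum.swap_restrict) (auto simp: trees_def finite_trees_on)
  also have "\<dots> = (\<Sum>i = 1..n. weight z a b i N *
       (\<Sum>T\<in>trees n. \<Prod>e\<in>T. edge_weight (weight z (a(i := a i + a N)) (b(i := b i + b N))) e))"
  proof (rule sum.cong [OF refl])
    fix i
    assume i: "i \<in> {1..n}"
    let ?h = "edge_weight (weight z (a(i := a i + a N)) (b(i := b i + b N)))"
    have "(\<Sum>E | E \<in> trees N \<and> i \<in> nbrs E N. R E * (\<Prod>j\<in>nbrs E N - {i}. g i j)) =
        (\<Sum>T\<in>trees n. (\<Prod>e | e \<in> T \<and> i \<notin> e. h e) * (\<Prod>j\<in>nbrs T i. h {i, j} + g i j))"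
    proof -
      have "insert N {1..n} = {1..N}"
        by (auto simp: N_def)
      then show ?thesis
        using sum_trees_contract [of "{1..n}" i N h "g i"] i
        by (simp add: R_def trees_def N_def)
    qed
    also have "\<dots> = (\<Sum>T\<in>trees n. \<Prod>e\<in>T. ?h e)"
    proof (rule sum.cong [OF refl])
      fix T
      assume "T \<in> trees n"
      then have T: "is_tree {1..n} T"
        by (simp add: trees_def)
      have "(\<Prod>e | e \<in> T \<and> i \<notin> e. h e) = (\<Prod>e | e \<in> T \<and> i \<notin> e. ?h e)"
      proof (rule prod.cong [OF refl])
        fix e
        assume "e \<in> {e. e \<in> T \<and> i \<notin> e}"
        then obtain x y where "e = {x, y}" "x \<noteq> i" "y \<noteq> i"
          using is_treeD(2) [OF T, of e] by auto
        then show "h e = ?h e"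
          by (simp add: h_def edge_weight_weight) (simp add: weight_def)
      qed
      \<comment> \<open>The numerator is linear in the exponents at \<open>i\<close>, so adding
        those of \<open>N\<close> adds exactly \<open>g i j\<close>.\<close>
      moreover have "(\<Prod>j\<in>nbrs T i. h {i, j} + g i j) = (\<Prod>j\<in>nbrs T i. ?h {i, j})"
      proof (rule prod.cong [OF refl])
        fix j
        assume "j \<in> nbrs T i"
        then have "j \<noteq> i"
          using is_treeD(1) [OF T, of i j] by (auto simp: nbrs_def)
        then show "h {i, j} + g i j = ?h {i, j}"
          unfolding h_def edge_weight_weight
          by (simp add: weight_def g_def add_divide_distrib [symmetric] algebra_simps)
      qed
      ultimately show "(\<Prod>e | e \<in> T \<and> i \<notin> e. h e) * (\<Prod>j\<in>nbrs T i. h {i, j} + g i j) = (\<Prod>e\<in>T. ?h e)"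
        using prod_edges_at [OF T, of ?h i] by simp
    qed
    finally have *: "(\<Sum>E | E \<in> trees N \<and> i \<in> nbrs E N. R E * (\<Prod>j\<in>nbrs E N - {i}. g i j)) =
        (\<Sum>T\<in>trees n. \<Prod>e\<in>T. ?h e)" .
    show "(\<Sum>E | E \<in> trees N \<and> i \<in> nbrs E N.
          weight z a b i N * (R E * (\<Prod>j\<in>nbrs E N - {i}. g i j))) =
        weight z a b i N * (\<Sum>T\<in>trees n. \<Prod>e\<in>T. ?h e)"
      unfolding sum_distrib_left [symmetric] * ..
  qed
  finally show ?thesis
    by (simp add: h_def)
qed

section \<open>Exponential fields\<close>

lemma eps_scale_scale: "c *\<^sub>\<epsilon> d *\<^sub>\<epsilon> x = (c * d) *\<^sub>\<epsilon> x"
  by (rule eps_alg_eqI) (simp add: eps_scale.rep_eq)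

lemma eps_scale_one: "1 *\<^sub>\<epsilon> x = x"
  by (rule eps_alg_eqI) (simp add: eps_scale.rep_eq)

lemma eps_scale_diff: "c *\<^sub>\<epsilon> x - d *\<^sub>\<epsilon> x = (c - d) *\<^sub>\<epsilon> x"
  by (rule eps_alg_eqI) (simp add: eps_scale.rep_eq minus_eps_alg.rep_eq left_diff_distrib)

lemma eps_scale_mult_left: "(c *\<^sub>\<epsilon> x) * y = c *\<^sub>\<epsilon> (x * y)"
  by (rule eps_alg_eqI)
    (simp add: eps_scale.rep_eq times_eps_alg.rep_eq sum_distrib_left mult.assoc)

lemma eps_scale_mult_right: "x * (c *\<^sub>\<epsilon> y) = c *\<^sub>\<epsilon> (x * y)"
  using eps_scale_mult_left [of c y x] by (simp add: mult.commute)

lemma eps_scale_sum: "(\<Sum>i\<in>A. c i *\<^sub>\<epsilon> x) = (\<Sum>i\<in>A. c i) *\<^sub>\<epsilon> x"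
proof (induction A rule: infinite_finite_induct)
  case (insert i A)
  moreover have "c i *\<^sub>\<epsilon> x + d *\<^sub>\<epsilon> x = (c i + d) *\<^sub>\<epsilon> x" for d
    by (rule eps_alg_eqI) (simp add: eps_scale.rep_eq plus_eps_alg.rep_eq distrib_right)
  ultimately show ?case by simp
qed (auto intro!: eps_alg_eqI simp: eps_scale.rep_eq zero_eps_alg.rep_eq)

text \<open>A family of fields that contains the plane waves and is closed under products, scaling
  and brackets. The amplitude \<open>e\<close> is an arbitrary algebra element, so that it can
  absorb factors constant in the current point.\<close>

definition exp_field :: "complex \<Rightarrow> complex \<Rightarrow> complex \<Rightarrow> complex \<Rightarrow> eps_alg \<Rightarrow> field" where
  "exp_field a b c d e = (\<lambda>(u, ub, w, wb). exp (a * u + b * w + c * ub + d * wb) *\<^sub>\<epsilon> e)"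

lemma du_exp_field: "du (exp_field a b c d e) = (\<lambda>X. a *\<^sub>\<epsilon> exp_field a b c d e X)"
proof
  fix X :: point
  obtain u ub w wb where X: "X = (u, ub, w, wb)"
    by (cases X)
  have "deriv (\<lambda>t. exp (a * t + b * w + c * ub + d * wb) * ecoeff e S) u =
      a * (exp (a * u + b * w + c * ub + d * wb) * ecoeff e S)" for S
    by (rule DERIV_imp_deriv) (auto intro!: derivative_eq_intros)
  then show "du (exp_field a b c d e) X = a *\<^sub>\<epsilon> exp_field a b c d e X"
    by (intro eps_alg_eqI)
      (simp add: X du_def eps_deriv_def exp_field_def Abs_eps_alg_inverse eps_scale.rep_eq)
qed

lemma dw_exp_field: "dw (exp_field a b c d e) = (\<lambda>X. b *\<^sub>\<epsilon> exp_field a b c d e X)"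
proof
  fix X :: point
  obtain u ub w wb where X: "X = (u, ub, w, wb)"
    by (cases X)
  have "deriv (\<lambda>t. exp (a * u + b * t + c * ub + d * wb) * ecoeff e S) w =
      b * (exp (a * u + b * w + c * ub + d * wb) * ecoeff e S)" for S
    by (rule DERIV_imp_deriv) (auto intro!: derivative_eq_intros)
  then show "dw (exp_field a b c d e) X = b *\<^sub>\<epsilon> exp_field a b c d e X"
    by (intro eps_alg_eqI)
      (simp add: X dw_def eps_deriv_def exp_field_def Abs_eps_alg_inverse eps_scale.rep_eq)
qed

lemma exp_field_mult_const: "exp_field a b c d e X * r = exp_field a b c d (e * r) X"
  by (auto simp: exp_field_def eps_scale_mult_left split: prod.splits)

lemma eps_scale_exp_field: "s *\<^sub>\<epsilon> exp_field a b c d e X = exp_field a b c d (s *\<^sub>\<epsilon> e) X"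
  by (auto simp: exp_field_def eps_scale_scale mult.commute split: prod.splits)

lemma exp_field_mult:
  "exp_field a b c d e X * exp_field a' b' c' d' e' X =
     exp_field (a + a') (b + b') (c + c') (d + d') (e * e') X"
proof -
  obtain u ub w wb where X: "X = (u, ub, w, wb)"
    by (cases X)
  show ?thesis
    by (simp add: X exp_field_def eps_scale_mult_left eps_scale_mult_right eps_scale_scale
        exp_add [symmetric] algebra_simps)
qed

lemma bracket_exp_field:
  "bracket (exp_field a b c d e) (exp_field a' b' c' d' e') X =
     (a * b' - b * a') *\<^sub>\<epsilon> (exp_field a b c d e X * exp_field a' b' c' d' e' X)"
  by (simp add: bracket_def du_exp_field dw_exp_field eps_scale_mult_left eps_scale_mult_right
      eps_scale_scale eps_scale_diff mult_ac)

section \<open>The perturbiner coefficient of exponential fields\<close>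

context
  fixes n :: nat and \<phi> :: "nat \<Rightarrow> field" and a b c d :: "nat \<Rightarrow> complex" and e :: "nat \<Rightarrow> eps_alg"
  assumes \<phi>: "\<And>k. k \<in> {1..n} \<Longrightarrow> \<phi> k = exp_field (a k) (b k) (c k) (d k) (e k)"
begin

text \<open>As a function of the point in slot \<open>i\<close> alone, the product is a single
  exponential: all other factors go into its amplitude. The scalar \<open>s\<close> collects the
  eigenvalues of operators applied earlier.\<close>

lemma slots_update:
  assumes "i \<in> {1..n}"
  obtains r where "\<And>Y s. s *\<^sub>\<epsilon> slots n \<phi> (Xs(i := Y)) = exp_field (a i) (b i) (c i) (d i) (s *\<^sub>\<epsilon> r) Y"
proof
  fix Y s
  have "slots n \<phi> (Xs(i := Y)) = \<phi> i Y * (\<Prod>k\<in>{1..n} - {i}. \<phi> k ((Xs(i := Y)) k))"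
    unfolding slots_def using assms by (subst prod.remove [where x = i]) auto
  also have "(\<Prod>k\<in>{1..n} - {i}. \<phi> k ((Xs(i := Y)) k)) = (\<Prod>k\<in>{1..n} - {i}. \<phi> k (Xs k))"
    by (rule prod.cong) auto
  finally show "s *\<^sub>\<epsilon> slots n \<phi> (Xs(i := Y)) =
      exp_field (a i) (b i) (c i) (d i) (s *\<^sub>\<epsilon> (e i * (\<Prod>k\<in>{1..n} - {i}. \<phi> k (Xs k)))) Y"
    by (simp only: \<phi> [OF assms] exp_field_mult_const eps_scale_exp_field)
qed

lemma in_slot_du_slots:
  assumes "i \<in> {1..n}"
  shows "in_slot i du (\<lambda>Xs. s *\<^sub>\<epsilon> slots n \<phi> Xs) = (\<lambda>Xs. (a i * s) *\<^sub>\<epsilon> slots n \<phi> Xs)"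
proof
  fix Xs
  obtain r where "\<And>Y s. s *\<^sub>\<epsilon> slots n \<phi> (Xs(i := Y)) = exp_field (a i) (b i) (c i) (d i) (s *\<^sub>\<epsilon> r) Y"
    using slots_update [OF assms] by blast
  \<comment> \<open>The instance at \<open>Xs i\<close> rewrites the undisturbed product, because
    updating slot \<open>i\<close> with its own point changes nothing.\<close>
  from this [of _ "Xs i"] this show
    "in_slot i du (\<lambda>Xs. s *\<^sub>\<epsilon> slots n \<phi> Xs) Xs = (a i * s) *\<^sub>\<epsilon> slots n \<phi> Xs"
    by (simp add: in_slot_def du_exp_field eps_scale_exp_field eps_scale_scale)
qed

lemma in_slot_dw_slots:
  assumes "i \<in> {1..n}"
  shows "in_slot i dw (\<lambda>Xs. s *\<^sub>\<epsilon> slots n \<phi> Xs) = (\<lambda>Xs. (b i * s) *\<^sub>\<epsilon> slots n \<phi> Xs)"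
proof
  fix Xs
  obtain r where "\<And>Y s. s *\<^sub>\<epsilon> slots n \<phi> (Xs(i := Y)) = exp_field (a i) (b i) (c i) (d i) (s *\<^sub>\<epsilon> r) Y"
    using slots_update [OF assms] by blast
  from this [of _ "Xs i"] this show
    "in_slot i dw (\<lambda>Xs. s *\<^sub>\<epsilon> slots n \<phi> Xs) Xs = (b i * s) *\<^sub>\<epsilon> slots n \<phi> Xs"
    by (simp add: in_slot_def dw_exp_field eps_scale_exp_field eps_scale_scale)
qed

lemma edge_op_slots:
  assumes "i \<in> {1..n}" "j \<in> {1..n}"
  shows "edge_op z (i, j) (\<lambda>Xs. s *\<^sub>\<epsilon> slots n \<phi> Xs) = (\<lambda>Xs. (weight z a b i j * s) *\<^sub>\<epsilon> slots n \<phi> Xs)"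
  using assms
  by (simp add: edge_op_def D_def in_slot_du_slots in_slot_dw_slots eps_scale_diff eps_scale_scale
      weight_def algebra_simps diff_divide_distrib)

lemma foldr_edge_op_slots:
  assumes "set es \<subseteq> {1..n} \<times> {1..n}"
  shows "foldr (edge_op z) es (slots n \<phi>) =
    (\<lambda>Xs. (\<Prod>(i, j)\<leftarrow>es. weight z a b i j) *\<^sub>\<epsilon> slots n \<phi> Xs)"
  using assms
proof (induction es)
  case Nil
  then show ?case by (simp add: eps_scale_one)
next
  case (Cons p es)
  then show ?case
    by (cases p) (simp add: edge_op_slots del: atLeastAtMost_iff)
qed

lemma prod_edge_list:
  assumes "E \<in> trees n"
  shows "(\<Prod>(i, j)\<leftarrow>edge_list n E. weight z a b i j) = (\<Prod>e\<in>E. edge_weight (weight z a b) e)"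
proof -
  have E: "is_tree {1..n} E"
    using assms by (simp add: trees_def)
  have "distinct (edge_list n E)"
    unfolding edge_list_def by (intro distinct_filter distinct_product) auto
  then have "(\<Prod>(i, j)\<leftarrow>edge_list n E. weight z a b i j) =
      (\<Prod>(i, j)\<in>set (edge_list n E). weight z a b i j)"
    by (simp add: prod.distinct_set_conv_list)
  also have "\<dots> = (\<Prod>e\<in>E. edge_weight (weight z a b) e)"
  proof (rule prod.reindex_bij_witness
      [where i = "\<lambda>e. (Min e, Max e)" and j = "\<lambda>(i, j). {i, j}"], goal_cases)
    case (3 e)
    then obtain x y where "e = {x, y}"
      using is_treeD(2) [OF E] by blast
    then show ?case
      by (cases x y rule: linorder_cases) auto
  next
    case (4 e)
    then obtain x y where "e = {x, y}" "x \<in> {1..n}" "y \<in> {1..n}" "x \<noteq> y"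
      using is_treeD(2) [OF E] by blast
    then show ?case
      using 4 by (cases x y rule: linorder_cases) (auto simp: edge_list_def insert_commute)
  qed (auto simp: edge_list_def edge_weight_weight)
  finally show ?thesis .
qed

text \<open>Every edge operator acts on the slot product as a scalar. Since the fields are arbitrary
  exponentials, this covers both the original seeds and the replaced ones.\<close>

lemma Phi_exp_fields:
  "Phi z n \<phi> X =
    (\<Sum>E\<in>trees n. \<Prod>e\<in>E. edge_weight (weight z a b) e) *\<^sub>\<epsilon> (\<Prod>k = 1..n. \<phi> k X)"
proof -
  have "foldr (edge_op z) (edge_list n E) (slots n \<phi>) (\<lambda>_. X) =
      (\<Prod>e\<in>E. edge_weight (weight z a b) e) *\<^sub>\<epsilon> (\<Prod>k = 1..n. \<phi> k X)"
    if "E \<in> trees n" for E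
  proof -
    have "set (edge_list n E) \<subseteq> {1..n} \<times> {1..n}"
      by (auto simp: edge_list_def)
    from foldr_edge_op_slots [OF this] prod_edge_list [OF that] show ?thesis
      by (simp add: slots_def)
  qed
  then show ?thesis
    by (simp add: Phi_def eps_scale_sum)
qed

end

section \<open>Application to plane waves\<close>

lemma plane_wave_exp_field:
  "plane_wave \<omega> z zb k = exp_field (\<i> * \<omega> k) (- \<i> * \<omega> k * zb k) (\<i> * \<omega> k * z k * zb k)
     (- \<i> * \<omega> k * z k) (eps k)"
  by (rule ext) (auto simp: plane_wave_def mom_def exp_field_def algebra_simps)

theorem theoremA1:
  fixes N :: nat
    and \<omega> z zb :: "nat \<Rightarrow> complex"
    and \<phi> :: "nat \<Rightarrow> field"
  assumes "N \<ge> 2"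
    and "\<And>i. i \<in> {1..N} \<Longrightarrow> \<omega> i \<noteq> 0"
    and "inj_on z {1..N}"
    and "\<And>i. i \<in> {1..N} \<Longrightarrow> \<phi> i = plane_wave \<omega> z zb i"
  shows "Phi z N \<phi> =
    (\<lambda>X. \<Sum>i = 1..N - 1.
       Phi z (N - 1) (\<phi>(i := (\<lambda>Y. (1 / (z i - z N)) *\<^sub>\<epsilon> bracket (\<phi> i) (\<phi> N) Y))) X)"
proof
  fix X
  define n where "n = N - 1"
  have N: "N = Suc n" "n \<ge> 1"
    using assms(1) by (auto simp: n_def)
  define a b c d where "a = (\<lambda>k. \<i> * \<omega> k)" and "b = (\<lambda>k. - \<i> * \<omega> k * zb k)"
    and "c = (\<lambda>k. \<i> * \<omega> k * z k * zb k)" and "d = (\<lambda>k. - \<i> * \<omega> k * z k)"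
  have \<phi>: "\<phi> k = exp_field (a k) (b k) (c k) (d k) (eps k)" if "k \<in> {1..N}" for k
    using assms(4) [OF that] by (simp add: plane_wave_exp_field a_def b_def c_def d_def)
  define P where "P = (\<Prod>k = 1..N. \<phi> k X)"
  have summand: "Phi z n (\<phi>(i := (\<lambda>Y. (1 / (z i - z N)) *\<^sub>\<epsilon> bracket (\<phi> i) (\<phi> N) Y))) X =
      (weight z a b i N * (\<Sum>T\<in>trees n. \<Prod>e\<in>T.
         edge_weight (weight z (a(i := a i + a N)) (b(i := b i + b N))) e)) *\<^sub>\<epsilon> P"
    (is "Phi z n ?\<phi> X = (_ * ?S) *\<^sub>\<epsilon> P")
    if i: "i \<in> {1..n}" for i
  proof -
    have iN: "i \<in> {1..N}" "N \<in> {1..N}"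
      using i N by auto
    have \<phi>i: "?\<phi> i = (\<lambda>Y. weight z a b i N *\<^sub>\<epsilon> (\<phi> i Y * \<phi> N Y))"
      unfolding \<phi> [OF iN(1)] \<phi> [OF iN(2)]
      by (simp add: bracket_exp_field eps_scale_scale weight_def mult.commute)
    \<comment> \<open>The replaced slot is again exponential: the exponents of \<open>i\<close> and
      \<open>N\<close> add, and the bracket eigenvalue divided by \<open>z i - z N\<close> enters
      the amplitude.\<close>
    have "?\<phi> k = exp_field ((a(i := a i + a N)) k) ((b(i := b i + b N)) k) ((c(i := c i + c N)) k)
        ((d(i := d i + d N)) k) ((eps(i := weight z a b i N *\<^sub>\<epsilon> (eps i * eps N))) k)"
      if "k \<in> {1..n}" for k
    proof (cases "k = i")
      case True
      then show ?thesis
        unfolding True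
        by (subst \<phi>i) (simp add: \<phi> [OF iN(1)] \<phi> [OF iN(2)] exp_field_mult eps_scale_exp_field)
    next
      case False
      then show ?thesis
        using \<phi> [of k] that N by simp
    qed
    then have "Phi z n ?\<phi> X = ?S *\<^sub>\<epsilon> (\<Prod>k = 1..n. ?\<phi> k X)"
      by (rule Phi_exp_fields)
    also have "(\<Prod>k = 1..n. ?\<phi> k X) = ?\<phi> i X * (\<Prod>k\<in>{1..n} - {i}. ?\<phi> k X)"
      by (rule prod.remove) (use i in auto)
    also have "(\<Prod>k\<in>{1..n} - {i}. ?\<phi> k X) = (\<Prod>k\<in>{1..n} - {i}. \<phi> k X)"
      by (rule prod.cong) auto
    \<comment> \<open>The factor of \<open>N\<close> hidden in slot \<open>i\<close> is pulled out,
      which restores the product \<open>P\<close> of all \<open>N\<close> seeds and leaves the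
      weight of \<open>{i, N}\<close>.\<close>
    also have "?\<phi> i X * \<dots> = weight z a b i N *\<^sub>\<epsilon> ((\<phi> i X * (\<Prod>k\<in>{1..n} - {i}. \<phi> k X)) * \<phi> N X)"
      unfolding \<phi>i by (simp add: eps_scale_mult_left eps_scale_mult_right mult_ac)
    also have "\<phi> i X * (\<Prod>k\<in>{1..n} - {i}. \<phi> k X) = (\<Prod>k = 1..n. \<phi> k X)"
      by (rule prod.remove [symmetric]) (use i in auto)
    also have "(\<Prod>k = 1..n. \<phi> k X) * \<phi> N X = P"
      by (simp add: P_def N)
    finally show ?thesis
      by (simp only: eps_scale_scale mult.commute [of ?S])
  qed
  have "Phi z N \<phi> X = (\<Sum>E\<in>trees N. \<Prod>e\<in>E. edge_weight (weight z a b) e) *\<^sub>\<epsilon> P"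
    unfolding P_def by (rule Phi_exp_fields [OF \<phi>])
  also have "\<dots> = (\<Sum>i = 1..n. Phi z n (\<phi>(i := (\<lambda>Y. (1 / (z i - z N)) *\<^sub>\<epsilon> bracket (\<phi> i) (\<phi> N) Y))) X)"
    using tree_sum_recursion [OF N(2), of z a b] assms(3) summand N(1) by (simp add: eps_scale_sum)
  finally show "Phi z N \<phi> X =
      (\<Sum>i = 1..N - 1. Phi z (N - 1) (\<phi>(i := (\<lambda>Y. (1 / (z i - z N)) *\<^sub>\<epsilon> bracket (\<phi> i) (\<phi> N) Y))) X)"
    by (simp add: n_def)
qed

end
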